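(* Let $(\underline{F},\overline{F})$ be a p-box on $(\Omega,\preceq)$, with natural extension $\underline{E}$ and conjugate $\overline{E}$. The natural extension $\underline{E}$ is given by the Choquet integral $$\underline{E}(f)=\inf f+\int_{\inf f}^{\sup f}\underline{E}(\{f\ge t\})\,\mathrm{d}t$$ for every gamble $f$. Moreover, $\underline{E}$ is completely monotone on all gambles. Similarly, for every gamble $f$, $$\overline{E}(f)=\inf f+\int_{\inf f}^{\sup f}\overline{E}(\{f\ge t\})\,\mathrm{d}t.$$
   Context: $(\Omega,\preceq)$ is a totally preordered set ($\preceq$ reflexive, transitive, any two elements comparable; antisymmetry not required) with a smallest element $0_\Omega$ and a largest element $1_\Omega$. Write $x\prec y$ if $x\preceq y$ and not $y\preceq x$; $[x,y]=\{z:x\preceq z\preceq y\}$, $(x,y]=\{z:x\prec z\preceq y\}$, etc. A gamble is a bounded function $\Omega\to\mathbb{R}$; an event is identified with its indicator; $\{f\ge t\}=\{x\in\Omega:f(x)\ge t\}$. A lower prevision on all gambles is coherent if $\underline{P}(f)\ge\inf f$, $\underline{P}(\lambda f)=\lambda\underline{P}(f)$, $\underline{P}(f+g)\ge\underline{P}(f)+\underline{P}(g)$ for all gambles $f,g$ and $\lambda\ge0$. A linear prevision is a functional $Q$ on all gambles with $Q(f)\ge\inf f$ and $Q(f+g)=Q(f)+Q(g)$. A cumulative distribution function is a map $F:\Omega\to[0,1]$, non-decreasing with respect to $\preceq$, with $F(1_\Omega)=1$. A p-box is a pair $(\underline{F},\overline{F})$ of cumulative distribution functions with $\underline{F}\le\overline{F}$.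 Its natural extension $\underline{E}$ is the pointwise smallest coherent lower prevision on all gambles with $\underline{E}([0_\Omega,x])=\underline{F}(x)$ and $\underline{E}((y,1_\Omega])=1-\overline{F}(y)$ for all $x,y\in\Omega$; equivalently $\underline{E}(f)=\min Q(f)$ over all linear previsions $Q$ with $\underline{F}(x)\le Q([0_\Omega,x])\le\overline{F}(x)$ for all $x\in\Omega$. The conjugate is $\overline{E}(f)=-\underline{E}(-f)$. A lower prevision $\underline{P}$ on all gambles is completely monotone if for all $p\in\mathbb{N}$ and all gambles $f,f_1,\dots,f_p$, $\sum_{I\subseteq\{1,\dots,p\}}(-1)^{|I|}\,\underline{P}\bigl(f\wedge\bigwedge_{i\in I}f_i\bigr)\ge0$, where $\wedge$ is the pointwise minimum. Integrals are Riemann integrals of monotone functions. *)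

theory Defs
  imports "HOL-Analysis.Analysis"
begin

text \<open>
  The strict relation of class \<open>preorder\<close> is \<open>x \<le> y \<and> \<not> y \<le> x\<close>.  Since antisymmetry is not assumed,
  smallest and largest elements need not be unique; \<open>bot\<close> and \<open>top\<close> are a fixed choice of them.
\<close>

class bounded_total_preorder = preorder + bot + top +
  assumes comparable: "x \<le> y \<or> y \<le> x"
    and bot_smallest: "bot \<le> x"
    and top_largest: "x \<le> top"

definition gamble :: "('a \<Rightarrow> real) \<Rightarrow> bool" where
  "gamble f \<longleftrightarrow> bounded (range f)"

text \<open>
  Previsions are total functions on \<open>'a \<Rightarrow> real\<close>; only their values on gambles are ever constrained.
\<close>

definition coherent :: "(('a \<Rightarrow> real) \<Rightarrow> real) \<Rightarrow> bool" where
  "coherent P \<longleftrightarrow>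
     (\<forall>f. gamble f \<longrightarrow> (INF x. f x) \<le> P f) \<and>
     (\<forall>f c. gamble f \<longrightarrow> 0 \<le> c \<longrightarrow> P (\<lambda>x. c * f x) = c * P f) \<and>
     (\<forall>f g. gamble f \<longrightarrow> gamble g \<longrightarrow> P f + P g \<le> P (\<lambda>x. f x + g x))"

definition conjugate :: "(('a \<Rightarrow> real) \<Rightarrow> real) \<Rightarrow> ('a \<Rightarrow> real) \<Rightarrow> real" where
  "conjugate P f = - P (\<lambda>x. - f x)"

definition cdf_on_preorder :: "('a::bounded_total_preorder \<Rightarrow> real) \<Rightarrow> bool" where
  "cdf_on_preorder F \<longleftrightarrow>
     range F \<subseteq> {0..1} \<and> monotone (\<le>) (\<le>) F \<and> F top = 1"

definition pbox ::
  "('a::bounded_total_preorder \<Rightarrow> real) \<Rightarrow> ('a \<Rightarrow> real) \<Rightarrow> bool" where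
  "pbox Fl Fu \<longleftrightarrow>
     cdf_on_preorder Fl \<and> cdf_on_preorder Fu \<and> (\<forall>x. Fl x \<le> Fu x)"

definition coherent_extension ::
  "('a::bounded_total_preorder \<Rightarrow> real) \<Rightarrow> ('a \<Rightarrow> real) \<Rightarrow> (('a \<Rightarrow> real) \<Rightarrow> real) \<Rightarrow> bool" where
  "coherent_extension Fl Fu P \<longleftrightarrow>
     coherent P \<and>
     (\<forall>x. P (indicator {bot..x}) = Fl x) \<and>
     (\<forall>y. P (indicator {y<..top}) = 1 - Fu y)"

definition is_natural_extension ::
  "('a::bounded_total_preorder \<Rightarrow> real) \<Rightarrow> ('a \<Rightarrow> real) \<Rightarrow> (('a \<Rightarrow> real) \<Rightarrow> real) \<Rightarrow> bool" where
  "is_natural_extension Fl Fu E \<longleftrightarrow>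
     coherent_extension Fl Fu E \<and>
     (\<forall>P. coherent_extension Fl Fu P \<longrightarrow> (\<forall>f. gamble f \<longrightarrow> E f \<le> P f))"

lemma natural_extension_unique:
  assumes "is_natural_extension Fl Fu E" "is_natural_extension Fl Fu E'" "gamble f"
  shows "E f = E' f"
  using assms unfolding is_natural_extension_def by (meson antisym)

text \<open>
  By the preceding uniqueness lemma, the choice operator only leaves open the irrelevant values on
  functions that are not gambles.
\<close>

definition natural_extension ::
  "('a::bounded_total_preorder \<Rightarrow> real) \<Rightarrow> ('a \<Rightarrow> real) \<Rightarrow> ('a \<Rightarrow> real) \<Rightarrow> real" where
  "natural_extension Fl Fu = (SOME E. is_natural_extension Fl Fu E)"

text \<open>
  The order \<open>p\<close> is at least 1: for \<open>p = 0\<close> the sum is just \<open>P f\<close>, which is negative for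
  coherent \<open>P\<close> and constant negative \<open>f\<close>.
\<close>

definition completely_monotone :: "(('a \<Rightarrow> real) \<Rightarrow> real) \<Rightarrow> bool" where
  "completely_monotone P \<longleftrightarrow>
     (\<forall>p\<ge>1. \<forall>f g. gamble f \<longrightarrow> (\<forall>i\<in>{1..p::nat}. gamble (g i)) \<longrightarrow>
        0 \<le> (\<Sum>I\<in>Pow {1..p}. (-1) ^ card I * P (\<lambda>x. Min (insert (f x) ((\<lambda>i. g i x) ` I)))))"

text \<open>
  The integral below is the Henstock-Kurzweil one, which agrees with the Riemann integral for
  monotone integrands; for monotone \<open>P\<close> the integrand is non-increasing in \<open>t\<close>.
\<close>

definition choquet_integral :: "(('a \<Rightarrow> real) \<Rightarrow> real) \<Rightarrow> ('a \<Rightarrow> real) \<Rightarrow> real" where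
  "choquet_integral P f =
     (INF x. f x) + integral {(INF x. f x)..(SUP x. f x)} (\<lambda>t. P (indicator {x. f x \<ge> t}))"

end

theory Submission
  imports Defs "HOL-Library.Option_ord"
begin

text \<open>
  A random quantity whose distribution function \<open>F\<close> lies between \<open>Fl\<close> and \<open>Fu\<close> can be thought of
  as the quantile of a uniform random level \<open>u\<close>.  Of this quantile one knows only that it is at
  most \<open>x\<close> whenever \<open>u < Fl x\<close>, and strictly above \<open>y\<close> whenever \<open>Fu y < u\<close>.  The intervals
  \<open>(y, x]\<close> with \<open>Fu y < u < Fl x\<close>, together with the initial segments of those \<open>x\<close> with
  \<open>u < Fl x\<close>, generate a proper filter \<open>quantile_filter Fl Fu u\<close>.  (Their intersection may be empty,
  because the order need not be complete, so that a filter is needed and a set would not do.)  With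
  the level \<open>u\<close> fixed, the most cautious assessment of a gamble \<open>f\<close> is its essential infimum
  \<open>filter_inf\<close> along that filter, and the natural extension turns out to be the average
  \<open>pbox_prevision\<close> of these essential infima over \<open>u\<close> in \<open>(0,1)\<close>.  In other words, a p-box is a
  random set up to passage from sets to filters, and all three claims descend from single filters.

  The essential infimum along a proper filter is coherent, commutes with finite minima, and is zero-one
  valued on events.  Commuting with minima reduces complete monotonicity to an inequality between
  real numbers, \<open>alternating_Min_sum_nonneg\<close>.  Being zero-one valued on events places the value at
  \<open>f\<close> between the lower and the upper sums that approximate the Choquet integral, and the same is
  true of the conjugate.  All these inequalities are linear in the functional and so survive averaging,
  and \<open>choquet_integral_eqI\<close> turns the sums into the integral.

  That the average is coherent with the prescribed values is a computation of Lebesgue measures of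
  sets of levels.  That no coherent extension \<open>P\<close> is smaller is seen first on events.  The levels
  whose filter contains an event \<open>A\<close> form an open set, exhausted up to any given error by finitely
  many \<open>(Fu y, Fl x)\<close> with \<open>(y, x]\<close> inside \<open>A\<close>.  Intervals \<open>(y, x]\<close> that meet can be merged, which only
  adds levels; once they are disjoint, superadditivity of \<open>P\<close> bounds \<open>P A\<close> below by the sum of
  \<open>Fl x - Fu y\<close> (\<open>pbox_prevision_indicator_le\<close>).  Gambles follow, because a coherent
  prevision is superadditive and hence dominates its own lower Choquet sums.
\<close>

section \<open>Gambles\<close>

lemma gamble_iff_bounds: "gamble f \<longleftrightarrow> (\<exists>B. \<forall>x. \<bar>f x\<bar> \<le> B)"
  unfolding gamble_def bounded_iff by auto

lemma gambleE:
  assumes "gamble f" obtains B where "\<And>x. \<bar>f x\<bar> \<le> B"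
  using assms unfolding gamble_iff_bounds by blast

lemma gamble_const [simp]: "gamble (\<lambda>_. c)"
  unfolding gamble_iff_bounds by blast

lemma gamble_indicator [simp]: "gamble (indicator A)"
  unfolding gamble_iff_bounds by (rule exI[of _ 1]) (simp add: indicator_def)

lemma gamble_add [simp]: "gamble f \<Longrightarrow> gamble g \<Longrightarrow> gamble (\<lambda>x. f x + g x)"
  unfolding gamble_def by (rule bounded_plus_comp)

lemma gamble_uminus [simp]: "gamble f \<Longrightarrow> gamble (\<lambda>x. - f x)"
  unfolding gamble_def by simp

lemma gamble_diff [simp]: "gamble f \<Longrightarrow> gamble g \<Longrightarrow> gamble (\<lambda>x. f x - g x)"
  unfolding gamble_def by (rule bounded_minus_comp)

lemma gamble_cmult [simp]: "gamble f \<Longrightarrow> gamble (\<lambda>x. c * f x)"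
  unfolding gamble_iff_bounds by (metis abs_ge_zero abs_mult mult_left_mono)

lemma gamble_sum [simp]:
  assumes "\<And>i. i \<in> S \<Longrightarrow> gamble (f i)"
  shows "gamble (\<lambda>x. \<Sum>i\<in>S. f i x)"
  using assms by (induction S rule: infinite_finite_induct) auto

lemma gamble_min [simp]:
  assumes "gamble f" "gamble g" shows "gamble (\<lambda>x. min (f x) (g x))"
proof -
  obtain B C where "\<And>x. \<bar>f x\<bar> \<le> B" "\<And>x. \<bar>g x\<bar> \<le> C" using assms by (auto elim!: gambleE)
  then have "\<bar>min (f x) (g x)\<bar> \<le> max B C" for x by (smt (verit))
  then show ?thesis unfolding gamble_iff_bounds by blast
qed

lemma gamble_Inf_le: "gamble f \<Longrightarrow> (INF x. f x) \<le> f x"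
  unfolding gamble_def by (meson UNIV_I bounded_imp_bdd_below cINF_lower)

lemma gamble_le_Sup: "gamble f \<Longrightarrow> f x \<le> (SUP x. f x)"
  unfolding gamble_def by (meson UNIV_I bounded_imp_bdd_above cSUP_upper)

section \<open>Coherent lower previsions\<close>

lemma coherent_ge_const:
  assumes "coherent P" "gamble f" "\<And>x. c \<le> f x" shows "c \<le> P f"
proof -
  have "c \<le> (INF x. f x)" using assms(3) by (intro cINF_greatest) auto
  then show ?thesis using assms(1,2) unfolding coherent_def by fastforce
qed

lemma coherent_superadditive:
  assumes "coherent P" "gamble f" "gamble g" shows "P f + P g \<le> P (\<lambda>x. f x + g x)"
  using assms unfolding coherent_def by blast

lemma coherent_scale:
  assumes "coherent P" "gamble f" "0 \<le> c" shows "P (\<lambda>x. c * f x) = c * P f"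
  using assms unfolding coherent_def by blast

lemma coherent_mono:
  assumes "coherent P" "gamble f" "gamble g" "\<And>x. f x \<le> g x" shows "P f \<le> P g"
proof -
  have "0 \<le> P (\<lambda>x. g x - f x)"
    by (rule coherent_ge_const[OF assms(1)]) (use assms in simp_all)
  then show ?thesis
    using coherent_superadditive[OF assms(1,2), of "\<lambda>x. g x - f x"] assms by simp
qed

lemma coherent_add_const:
  assumes "coherent P" "gamble f" shows "P f + c \<le> P (\<lambda>x. f x + c)"
  using coherent_superadditive[OF assms gamble_const, of c]
    coherent_ge_const[OF assms(1) gamble_const order_refl, of c] by linarith

lemma coherent_const:
  assumes "coherent P" shows "P (\<lambda>_. c) = c"
proof -
  have "P (\<lambda>_. 0) = 0" using coherent_scale[OF assms, of "\<lambda>_. 0" 0] by simp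
  then have "P (\<lambda>_. c) + P (\<lambda>_. - c) \<le> 0"
    using coherent_superadditive[OF assms, of "\<lambda>_. c" "\<lambda>_. - c"] by simp
  moreover have "- c \<le> P (\<lambda>_. - c)" "c \<le> P (\<lambda>_. c)" by (rule coherent_ge_const[OF assms gamble_const order_refl])+
  ultimately show ?thesis by linarith
qed

lemma coherent_sum:
  assumes "coherent P" "\<And>i. i \<in> S \<Longrightarrow> gamble (f i)"
  shows "(\<Sum>i\<in>S. P (f i)) \<le> P (\<lambda>x. \<Sum>i\<in>S. f i x)"
  using assms(2)
proof (induction S rule: infinite_finite_induct)
  case (insert i S)
  then show ?case using coherent_superadditive[OF assms(1), of "f i" "\<lambda>x. \<Sum>i\<in>S. f i x"] by fastforce
qed (simp_all add: coherent_const[OF assms(1)])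

section \<open>Layer sums and the Choquet integral\<close>

text \<open>
  The number \<open>c\<close> is the sum of the lengths of the pieces that the grid with step \<open>d\<close> cuts from
  \<open>[0, c]\<close>, and the flag \<open>w k\<close> says that \<open>c\<close> reaches the grid point \<open>k * d\<close>.  The flag may take
  either value when \<open>c\<close> equals that grid point; this matters when \<open>c\<close> comes from an
  essential infimum, which may fail to be an eventual lower bound.
\<close>

lemma layer_sums_real:
  fixes c d :: real and w :: "nat \<Rightarrow> real"
  assumes c: "0 \<le> c" "c \<le> real n * d" and d: "0 \<le> d"
    and w: "\<And>k. w k = 0 \<or> w k = 1"
    and w1: "\<And>k. w k = 1 \<Longrightarrow> real k * d \<le> c" and w0: "\<And>k. w k = 0 \<Longrightarrow> c \<le> real k * d"
  shows "(\<Sum>k<n. d * w (Suc k)) \<le> c" "c \<le> (\<Sum>k<n. d * w k)"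
proof -
  have "(\<Sum>k<n. min c (real (Suc k) * d) - min c (real k * d)) = min c (real n * d) - min c (real 0 * d)"
    by (rule sum_lessThan_telescope)
  also have "\<dots> = c" using c by simp
  finally have tele: "(\<Sum>k<n. min c (real (Suc k) * d) - min c (real k * d)) = c" .
  have "d * w (Suc k) \<le> min c (real (Suc k) * d) - min c (real k * d)
      \<and> min c (real (Suc k) * d) - min c (real k * d) \<le> d * w k" for k
  proof -
    have *: "real (Suc k) * d = real k * d + d" by (simp add: algebra_simps)
    show ?thesis using w[of k] w[of "Suc k"] w1[of "Suc k"] w0[of k] d unfolding * by auto
  qed
  then have "(\<Sum>k<n. d * w (Suc k)) \<le> (\<Sum>k<n. min c (real (Suc k) * d) - min c (real k * d))"
    "(\<Sum>k<n. min c (real (Suc k) * d) - min c (real k * d)) \<le> (\<Sum>k<n. d * w k)"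
    by (intro sum_mono; simp)+
  then show "(\<Sum>k<n. d * w (Suc k)) \<le> c" "c \<le> (\<Sum>k<n. d * w k)" using tele by auto
qed

text \<open>
  The lower and upper sums of an antitone function on a grid with \<open>n\<close> steps differ by at most
  \<open>(b - a) * (h a - h b) / n\<close>, and both the integral and \<open>c\<close> lie between them.
\<close>

lemma integral_antitone_eqI_layer_sums:
  fixes h :: "real \<Rightarrow> real"
  assumes ab: "a \<le> b" and h: "antimono h"
    and lower: "\<And>n. 0 < n \<Longrightarrow> (\<Sum>k<n. (b - a) / real n * h (a + real (Suc k) * ((b - a) / real n))) \<le> c"
    and upper: "\<And>n. 0 < n \<Longrightarrow> c \<le> (\<Sum>k<n. (b - a) / real n * h (a + real k * ((b - a) / real n)))"
  shows "integral {a..b} h = c"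
proof -
  have "mono (\<lambda>t. - h t)" using h by (auto simp: mono_def antimono_def)
  then have "(\<lambda>t. - (- h t)) \<in> borel_measurable borel"
    by (intro borel_measurable_uminus borel_measurable_mono)
  then have meas: "h \<in> borel_measurable borel" by simp
  have int: "h integrable_on {x..y}" for x y
  proof -
    have "\<bar>h t\<bar> \<le> max \<bar>h x\<bar> \<bar>h y\<bar>" if "t \<in> {x..y}" for t
      using that antimonoD[OF h, of x t] antimonoD[OF h, of t y] by auto
    then have "set_integrable lborel {x..y} h" unfolding set_integrable_def using meas
      by (intro integrableI_bounded_set[where A="{x..y}" and B="max \<bar>h x\<bar> \<bar>h y\<bar>"])
        (auto simp: indicator_def emeasure_lborel_Icc_eq)
    then show ?thesis by (rule set_borel_integral_eq_integral)
  qed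
  have bounds: "(\<Sum>k<n. d * h (a + real (Suc k) * d)) \<le> integral {a..a + real n * d} h
      \<and> integral {a..a + real n * d} h \<le> (\<Sum>k<n. d * h (a + real k * d))" if d: "0 \<le> d" for d :: real and n
  proof (induction n)
    case (Suc n)
    let ?s = "a + real n * d" and ?t = "a + real (Suc n) * d"
    have st: "a \<le> ?s" "?s \<le> ?t" using d by (auto simp: algebra_simps)
    have eq: "integral {a..?t} h = integral {a..?s} h + integral {?s..?t} h"
      using st int by (intro Henstock_Kurzweil_Integration.integral_combine[symmetric]) auto
    have "integral {?s..?t} (\<lambda>_. h ?t) \<le> integral {?s..?t} h" "integral {?s..?t} h \<le> integral {?s..?t} (\<lambda>_. h ?s)"
      using int by (intro integral_le; auto intro: antimonoD[OF h])+
    then have "d * h ?t \<le> integral {?s..?t} h" "integral {?s..?t} h \<le> d * h ?s"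
      using st d by (auto simp: algebra_simps)
    then show ?case using Suc eq by simp
  qed simp
  have close: "\<bar>integral {a..b} h - c\<bar> \<le> (b - a) * (h a - h b) * (1 / real (Suc n))" for n
  proof -
    define d where "d = (b - a) / real (Suc n)"
    have d: "0 \<le> d" "a + real (Suc n) * d = b" using ab by (auto simp: d_def)
    have "(\<Sum>k<Suc n. d * h (a + real k * d)) - (\<Sum>k<Suc n. d * h (a + real (Suc k) * d))
        = (\<Sum>k<Suc n. d * h (a + real k * d) - d * h (a + real (Suc k) * d))" by (rule sum_subtractf[symmetric])
    also have "\<dots> = d * h (a + 0 * d) - d * h (a + real (Suc n) * d)"
      using sum_lessThan_telescope'[of "\<lambda>k. d * h (a + real k * d)" "Suc n"] by simp
    also have "\<dots> = d * (h a - h b)" using d by (simp add: algebra_simps)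
    finally have "\<bar>integral {a..b} h - c\<bar> \<le> d * (h a - h b)"
      using bounds[OF d(1), of "Suc n"] lower[of "Suc n", folded d_def] upper[of "Suc n", folded d_def]
      unfolding d(2) by linarith
    then show ?thesis by (simp add: d_def)
  qed
  have "(\<lambda>n. (b - a) * (h a - h b) * (1 / real (Suc n))) \<longlonglongrightarrow> (b - a) * (h a - h b) * 0"
    by (intro tendsto_intros LIMSEQ_Suc[OF lim_1_over_n])
  then have "\<bar>integral {a..b} h - c\<bar> \<le> (b - a) * (h a - h b) * 0"
    by (rule LIMSEQ_le_const) (use close in blast)
  then show ?thesis by simp
qed

definition layer_step :: "('a \<Rightarrow> real) \<Rightarrow> nat \<Rightarrow> real" where
  "layer_step f n = ((SUP x. f x) - (INF x. f x)) / real n"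

definition layer :: "('a \<Rightarrow> real) \<Rightarrow> nat \<Rightarrow> nat \<Rightarrow> 'a set" where
  "layer f n k = {x. (INF x. f x) + real k * layer_step f n \<le> f x}"

lemma layer_step_nonneg:
  assumes "gamble f" shows "0 \<le> layer_step f n"
proof -
  have "(INF x. f x) \<le> (SUP x. f x)"
    using gamble_Inf_le[OF assms] gamble_le_Sup[OF assms] by (rule order_trans)
  then show ?thesis by (simp add: layer_step_def)
qed

lemma choquet_integral_eqI:
  assumes f: "gamble f"
    and mono: "\<And>A B. A \<subseteq> B \<Longrightarrow> P (indicator A) \<le> P (indicator B)"
    and lower: "\<And>n. 0 < n \<Longrightarrow>
      (INF x. f x) + (\<Sum>k<n. layer_step f n * P (indicator (layer f n (Suc k)))) \<le> P f"
    and upper: "\<And>n. 0 < n \<Longrightarrow>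
      P f \<le> (INF x. f x) + (\<Sum>k<n. layer_step f n * P (indicator (layer f n k)))"
  shows "choquet_integral P f = P f"
proof -
  have "(INF x. f x) \<le> (SUP x. f x)"
    using gamble_Inf_le[OF f] gamble_le_Sup[OF f] by (rule order_trans)
  then have "integral {(INF x. f x)..(SUP x. f x)} (\<lambda>t. P (indicator {x. t \<le> f x})) = P f - (INF x. f x)"
  proof (rule integral_antitone_eqI_layer_sums)
    show "antimono (\<lambda>t. P (indicator {x. t \<le> f x}))" by (intro antimonoI mono) auto
  qed (use lower upper in \<open>simp_all add: layer_def layer_step_def le_diff_eq diff_le_eq add.commute\<close>)
  then show ?thesis unfolding choquet_integral_def by simp
qed

text \<open>
  Every gamble dominates its lower layer sum pointwise, so superadditivity suffices.  Only this
  half of the Choquet formula holds for all coherent previsions.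
\<close>

lemma coherent_layer_sum:
  assumes P: "coherent P" and f: "gamble f" and n: "0 < n"
  shows "(INF x. f x) + (\<Sum>k<n. layer_step f n * P (indicator (layer f n (Suc k)))) \<le> P f"
proof -
  let ?a = "INF x. f x" and ?d = "layer_step f n" and ?A = "\<lambda>k. layer f n (Suc k)"
  note d = layer_step_nonneg[OF f]
  have gam: "gamble (\<lambda>x. ?d * indicator (?A k) x)" for k by (rule gamble_cmult) simp
  have gamsum: "gamble (\<lambda>x. \<Sum>k<n. ?d * indicator (?A k) x)" by (rule gamble_sum) (rule gam)
  have "(\<Sum>k<n. ?d * P (indicator (?A k))) = (\<Sum>k<n. P (\<lambda>x. ?d * indicator (?A k) x))"
    using coherent_scale[OF P _ d] by simp
  also have "\<dots> \<le> P (\<lambda>x. \<Sum>k<n. ?d * indicator (?A k) x)"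
    using gam by (rule coherent_sum[OF P])
  finally have "?a + (\<Sum>k<n. ?d * P (indicator (?A k))) \<le> P (\<lambda>x. (\<Sum>k<n. ?d * indicator (?A k) x) + ?a)"
    using coherent_add_const[OF P gamsum, of ?a] by linarith
  also have "\<dots> \<le> P f"
  proof (rule coherent_mono[OF P _ f])
    show "gamble (\<lambda>x. (\<Sum>k<n. ?d * indicator (?A k) x) + ?a)"
      by (rule gamble_add[OF gamsum]) simp
  next
    fix x
    have "(\<Sum>k<n. ?d * indicator (?A k) x) \<le> f x - ?a"
    proof (rule layer_sums_real(1)[where w = "\<lambda>k. indicator (layer f n k) x"])
      show "f x - ?a \<le> real n * ?d"
        using n gamble_le_Sup[OF f, of x] by (simp add: layer_step_def)
    qed (use d gamble_Inf_le[OF f, of x] in \<open>auto simp: layer_def indicator_def split: if_splits\<close>)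
    then show "(\<Sum>k<n. ?d * indicator (?A k) x) + ?a \<le> f x" by simp
  qed
  finally show ?thesis .
qed

section \<open>Essential infimum along a filter\<close>

text \<open>
  For the principal filter of a nonempty set this is the vacuous lower prevision of that set, the infimum
  over it; for a general filter it is the limit inferior.
\<close>

definition filter_inf :: "'a filter \<Rightarrow> ('a \<Rightarrow> real) \<Rightarrow> real" where
  "filter_inf F f = Sup {t. \<forall>\<^sub>F z in F. t \<le> f z}"

lemma filter_inf_bdd_above:
  assumes "F \<noteq> bot" "gamble f" shows "bdd_above {t. \<forall>\<^sub>F z in F. t \<le> f z}"
proof -
  have "t \<le> (SUP x. f x)" if ev: "\<forall>\<^sub>F z in F. t \<le> f z" for t
  proof -
    obtain z where "t \<le> f z" using eventually_happens[OF ev] assms(1) by blast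
    then show ?thesis using gamble_le_Sup[OF assms(2), of z] by linarith
  qed
  then show ?thesis unfolding bdd_above_def by blast
qed

lemma le_filter_inf:
  assumes "F \<noteq> bot" "gamble f" "\<forall>\<^sub>F z in F. t \<le> f z" shows "t \<le> filter_inf F f"
  unfolding filter_inf_def by (rule cSup_upper[OF _ filter_inf_bdd_above]) (use assms in simp_all)

lemma less_filter_inf_iff:
  assumes "F \<noteq> bot" "gamble f"
  shows "t < filter_inf F f \<longleftrightarrow> (\<exists>s>t. \<forall>\<^sub>F z in F. s \<le> f z)"
proof -
  have "(INF x. f x) \<in> {t. \<forall>\<^sub>F z in F. t \<le> f z}"
    using gamble_Inf_le[OF assms(2)] by simp
  then have ne: "{t. \<forall>\<^sub>F z in F. t \<le> f z} \<noteq> {}" by blast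
  show ?thesis
    unfolding filter_inf_def less_cSup_iff[OF ne filter_inf_bdd_above[OF assms]] by auto
qed

lemma eventually_of_less_filter_inf:
  assumes "F \<noteq> bot" "gamble f" "t < filter_inf F f"
  shows "\<forall>\<^sub>F z in F. t \<le> f z"
proof -
  obtain s where "t < s" "\<forall>\<^sub>F z in F. s \<le> f z"
    using assms(3) unfolding less_filter_inf_iff[OF assms(1,2)] by blast
  then show ?thesis by (simp add: eventually_mono)
qed

text \<open>
  Sums need an \<open>e / 2\<close> on each side, because the essential infimum need not be an eventual lower
  bound itself: only smaller numbers are.
\<close>

lemma coherent_filter_inf:
  assumes F: "F \<noteq> bot" shows "coherent (filter_inf F)"
  unfolding coherent_def
proof (intro conjI allI impI)
  fix f :: "'a \<Rightarrow> real" assume f: "gamble f"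
  show "(INF x. f x) \<le> filter_inf F f"
    by (rule le_filter_inf[OF F f]) (simp add: gamble_Inf_le[OF f])
next
  have scale_le: "c * filter_inf F f \<le> filter_inf F (\<lambda>x. c * f x)"
    if f: "gamble f" and c: "0 < c" for f :: "'a \<Rightarrow> real" and c
  proof -
    have "filter_inf F f \<le> filter_inf F (\<lambda>x. c * f x) / c"
    proof (rule dense_le)
      fix t assume "t < filter_inf F f"
      then have "\<forall>\<^sub>F z in F. t \<le> f z" by (rule eventually_of_less_filter_inf[OF F f])
      then have "\<forall>\<^sub>F z in F. c * t \<le> c * f z" by eventually_elim (use c in simp)
      then have "c * t \<le> filter_inf F (\<lambda>x. c * f x)"
        by (rule le_filter_inf[OF F gamble_cmult[OF f]])
      then show "t \<le> filter_inf F (\<lambda>x. c * f x) / c" using c by (simp add: field_simps)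
    qed
    then show ?thesis using c by (simp add: field_simps)
  qed
  fix f :: "'a \<Rightarrow> real" and c :: real assume f: "gamble f" and "0 \<le> c"
  show "filter_inf F (\<lambda>x. c * f x) = c * filter_inf F f"
  proof (cases "c = 0")
    case True
    have "{t::real. \<forall>\<^sub>F z in F. t \<le> 0} = {..0}" using F by (simp add: atMost_def)
    then show ?thesis using True by (simp add: filter_inf_def)
  next
    case False
    then have c: "0 < c" using \<open>0 \<le> c\<close> by simp
    have "(1 / c) * filter_inf F (\<lambda>x. c * f x) \<le> filter_inf F f"
      using scale_le[OF gamble_cmult[OF f], of "1 / c" c] c by simp
    then show ?thesis using scale_le[OF f c] c by (simp add: field_simps)
  qed
next
  fix f g :: "'a \<Rightarrow> real" assume f: "gamble f" and g: "gamble g"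
  show "filter_inf F f + filter_inf F g \<le> filter_inf F (\<lambda>x. f x + g x)"
  proof (rule field_le_epsilon)
    fix e :: real assume "0 < e"
    then have "\<forall>\<^sub>F z in F. filter_inf F f - e / 2 \<le> f z" "\<forall>\<^sub>F z in F. filter_inf F g - e / 2 \<le> g z"
      by (intro eventually_of_less_filter_inf[OF F] f g; simp)+
    then have "\<forall>\<^sub>F z in F. filter_inf F f + filter_inf F g - e \<le> f z + g z"
      by eventually_elim linarith
    then have "filter_inf F f + filter_inf F g - e \<le> filter_inf F (\<lambda>x. f x + g x)"
      by (rule le_filter_inf[OF F gamble_add[OF f g]])
    then show "filter_inf F f + filter_inf F g \<le> filter_inf F (\<lambda>x. f x + g x) + e" by linarith
  qed
qed

lemma filter_inf_le:
  assumes "F \<noteq> bot" "gamble f" "\<And>x. f x \<le> c" shows "filter_inf F f \<le> c"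
  using coherent_mono[OF coherent_filter_inf[OF assms(1)] assms(2) gamble_const, of c] assms(3)
    coherent_const[OF coherent_filter_inf[OF assms(1)]] by simp

text \<open>
  Two lower bounds that hold eventually hold eventually together; this is where it matters that
  a filter is closed under intersection.
\<close>

lemma filter_inf_min:
  assumes F: "F \<noteq> bot" and f: "gamble f" and g: "gamble g"
  shows "filter_inf F (\<lambda>x. min (f x) (g x)) = min (filter_inf F f) (filter_inf F g)"
proof (rule antisym)
  show "filter_inf F (\<lambda>x. min (f x) (g x)) \<le> min (filter_inf F f) (filter_inf F g)"
    using coherent_mono[OF coherent_filter_inf[OF F] gamble_min[OF f g] f]
      coherent_mono[OF coherent_filter_inf[OF F] gamble_min[OF f g] g] by simp
  show "min (filter_inf F f) (filter_inf F g) \<le> filter_inf F (\<lambda>x. min (f x) (g x))"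
  proof (rule dense_le)
    fix t assume "t < min (filter_inf F f) (filter_inf F g)"
    then have "\<forall>\<^sub>F z in F. t \<le> f z" "\<forall>\<^sub>F z in F. t \<le> g z"
      by (intro eventually_of_less_filter_inf[OF F] f g; simp)+
    then have "\<forall>\<^sub>F z in F. t \<le> min (f z) (g z)" by eventually_elim simp
    then show "t \<le> filter_inf F (\<lambda>x. min (f x) (g x))"
      by (rule le_filter_inf[OF F gamble_min[OF f g]])
  qed
qed

lemma filter_inf_indicator:
  assumes F: "F \<noteq> bot"
  shows "filter_inf F (indicator A) = (if \<forall>\<^sub>F z in F. z \<in> A then 1 else 0)"
proof -
  note le = le_filter_inf[OF F gamble_indicator, of _ A]
  have le1: "filter_inf F (indicator A) \<le> 1"
    by (rule filter_inf_le[OF F gamble_indicator]) (simp add: indicator_def)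
  have ge0: "0 \<le> filter_inf F (indicator A)" by (rule le) (simp add: indicator_def)
  show ?thesis
  proof (cases "\<forall>\<^sub>F z in F. z \<in> A")
    case True
    then have "\<forall>\<^sub>F z in F. (1::real) \<le> indicator A z" by eventually_elim simp
    from le[OF this] show ?thesis using True le1 by simp
  next
    case False
    have "\<not> 0 < filter_inf F (indicator A)"
    proof
      assume "0 < filter_inf F (indicator A)"
      then obtain s :: real where s: "0 < s" "\<forall>\<^sub>F z in F. s \<le> indicator A z"
        unfolding less_filter_inf_iff[OF F gamble_indicator] by blast
      from s(2) have "\<forall>\<^sub>F z in F. z \<in> A"
        by eventually_elim (use s(1) in \<open>auto simp: indicator_def of_bool_def split: if_splits\<close>)
      then show False using False by blast
    qed
    then show ?thesis using False ge0 by simp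
  qed
qed

lemma conjugate_filter_inf_indicator:
  assumes F: "F \<noteq> bot"
  shows "conjugate (filter_inf F) (indicator A) = (if \<forall>\<^sub>F z in F. z \<notin> A then 0 else 1)"
proof -
  note coh = coherent_filter_inf[OF F]
  have 1: "(\<lambda>x. - indicator A x) = (\<lambda>x. indicator (- A) x + (- 1 :: real))"
    by (auto simp: indicator_def)
  have 2: "indicator (- A) = (\<lambda>x. - indicator A x + (1 :: real))" by (auto simp: indicator_def)
  have "filter_inf F (\<lambda>x. - indicator A x) = filter_inf F (indicator (- A)) - 1"
    using coherent_add_const[OF coh gamble_indicator[of "- A"], of "- 1", folded 1]
      coherent_add_const[OF coh gamble_uminus[OF gamble_indicator[of A]], of 1, folded 2]
    by linarith
  then show ?thesis by (simp add: conjugate_def filter_inf_indicator[OF F])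
qed

section \<open>Layer sums of functionals that are zero-one valued on events\<close>

text \<open>
  On the chain of events \<open>t \<le> f\<close> a zero-one valued \<open>W\<close> jumps once, and the hypotheses say
  that it jumps at \<open>W f\<close>.  Stating this for arbitrary \<open>W\<close> covers both the essential infimum and its
  conjugate, the essential supremum, of which only one is superadditive.
\<close>

lemma zero_one_layer_sums:
  assumes f: "gamble f" and n: "0 < n" and W: "(INF x. f x) \<le> W f" "W f \<le> (SUP x. f x)"
    and zero_one: "\<And>t. W (indicator {x. t \<le> f x}) = 0 \<or> W (indicator {x. t \<le> f x}) = 1"
    and one: "\<And>t. W (indicator {x. t \<le> f x}) = 1 \<Longrightarrow> t \<le> W f"
    and zero: "\<And>t. W (indicator {x. t \<le> f x}) = 0 \<Longrightarrow> W f \<le> t"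
  shows "(INF x. f x) + (\<Sum>k<n. layer_step f n * W (indicator (layer f n (Suc k)))) \<le> W f"
    and "W f \<le> (INF x. f x) + (\<Sum>k<n. layer_step f n * W (indicator (layer f n k)))"
proof -
  let ?w = "\<lambda>k. W (indicator (layer f n k))"
  have 1: "0 \<le> W f - (INF x. f x)" "W f - (INF x. f x) \<le> real n * layer_step f n"
    using n W by (simp_all add: layer_step_def)
  have 2: "?w k = 0 \<or> ?w k = 1" for k
    unfolding layer_def by (rule zero_one)
  have 3: "real k * layer_step f n \<le> W f - (INF x. f x)" if "?w k = 1" for k
    using one[OF that[unfolded layer_def]] by simp
  have 4: "W f - (INF x. f x) \<le> real k * layer_step f n" if "?w k = 0" for k
    using zero[OF that[unfolded layer_def]] by simp
  show "(INF x. f x) + (\<Sum>k<n. layer_step f n * ?w (Suc k)) \<le> W f"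
    using layer_sums_real(1)[where w = ?w, OF 1 layer_step_nonneg[OF f] 2 3 4] by simp
  show "W f \<le> (INF x. f x) + (\<Sum>k<n. layer_step f n * ?w k)"
    using layer_sums_real(2)[where w = ?w, OF 1 layer_step_nonneg[OF f] 2 3 4] by simp
qed

text \<open>
  The lower bound is an instance of \<open>coherent_layer_sum\<close>, so that only the upper one is
  recorded.
\<close>

lemma filter_inf_layer_sums:
  assumes F: "F \<noteq> bot" and f: "gamble f" and n: "0 < n"
  shows "filter_inf F f
      \<le> (INF x. f x) + (\<Sum>k<n. layer_step f n * filter_inf F (indicator (layer f n k)))"
proof (rule zero_one_layer_sums(2)[OF f n])
  fix t
  show "t \<le> filter_inf F f" if "filter_inf F (indicator {x. t \<le> f x}) = 1"
    using that by (intro le_filter_inf[OF F f]) (simp add: filter_inf_indicator[OF F] split: if_splits)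
  show "filter_inf F f \<le> t" if "filter_inf F (indicator {x. t \<le> f x}) = 0"
  proof (rule ccontr)
    assume "\<not> filter_inf F f \<le> t"
    then have "\<forall>\<^sub>F z in F. t \<le> f z" by (intro eventually_of_less_filter_inf[OF F f]) simp
    then show False using that by (simp add: filter_inf_indicator[OF F])
  qed
next
  show "(INF x. f x) \<le> filter_inf F f"
    by (rule coherent_ge_const[OF coherent_filter_inf[OF F] f gamble_Inf_le[OF f]])
  show "filter_inf F f \<le> (SUP x. f x)" by (rule filter_inf_le[OF F f gamble_le_Sup[OF f]])
qed (simp add: filter_inf_indicator[OF F])

lemma conjugate_filter_inf_layer_sums:
  assumes F: "F \<noteq> bot" and f: "gamble f" and n: "0 < n"
  defines "W \<equiv> conjugate (filter_inf F)"
  shows "(INF x. f x) + (\<Sum>k<n. layer_step f n * W (indicator (layer f n (Suc k)))) \<le> W f"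
    and "W f \<le> (INF x. f x) + (\<Sum>k<n. layer_step f n * W (indicator (layer f n k)))"
proof -
  note f' = gamble_uminus[OF f] and ind = conjugate_filter_inf_indicator[OF F]
  have 1: "(INF x. f x) \<le> W f"
    using filter_inf_le[OF F f', of "- (INF x. f x)"] gamble_Inf_le[OF f] by (simp add: W_def conjugate_def)
  have 2: "W f \<le> (SUP x. f x)"
    using coherent_ge_const[OF coherent_filter_inf[OF F] f', of "- (SUP x. f x)"] gamble_le_Sup[OF f]
    by (simp add: W_def conjugate_def)
  have 3: "t \<le> W f" if "W (indicator {x. t \<le> f x}) = 1" for t
  proof (rule ccontr)
    assume "\<not> t \<le> W f"
    then have "- t < filter_inf F (\<lambda>x. - f x)" by (simp add: W_def conjugate_def)
    then obtain s where "- t < s" "\<forall>\<^sub>F z in F. s \<le> - f z"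
      unfolding less_filter_inf_iff[OF F f'] by blast
    then have "\<forall>\<^sub>F z in F. z \<notin> {x. t \<le> f x}" by (auto elim: eventually_mono)
    then show False using that by (simp add: W_def ind)
  qed
  have 4: "W f \<le> t" if "W (indicator {x. t \<le> f x}) = 0" for t
  proof -
    have "\<forall>\<^sub>F z in F. z \<notin> {x. t \<le> f x}" using that by (simp add: W_def ind split: if_splits)
    then have "\<forall>\<^sub>F z in F. - t \<le> - f z" by (rule eventually_mono) simp
    from le_filter_inf[OF F f' this] show ?thesis by (simp add: W_def conjugate_def)
  qed
  have 5: "W (indicator {x. t \<le> f x}) = 0 \<or> W (indicator {x. t \<le> f x}) = 1" for t
    by (simp add: W_def ind)
  show "(INF x. f x) + (\<Sum>k<n. layer_step f n * W (indicator (layer f n (Suc k)))) \<le> W f"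
    "W f \<le> (INF x. f x) + (\<Sum>k<n. layer_step f n * W (indicator (layer f n k)))"
    by (rule zero_one_layer_sums[where W = W, OF f n 1 2 5 3 4]; assumption)+
qed

section \<open>Alternating sums of minima\<close>

lemma Min_insert_insert:
  fixes a b :: "'b::linorder"
  assumes "finite B" shows "Min (insert a (insert b B)) = min (Min (insert a B)) b"
  using assms by (cases "B = {}") (simp_all add: ac_simps)

text \<open>
  The subsets that contain \<open>j\<close> contribute with the opposite sign, and for them \<open>d j\<close> can be
  absorbed into the cap \<open>c\<close>.
\<close>

lemma alternating_Min_sum_insert:
  fixes c :: real and d :: "'i \<Rightarrow> real"
  assumes "finite S" "j \<notin> S"
  shows "(\<Sum>I\<in>Pow (insert j S). (-1) ^ card I * Min (insert c (d ` I)))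
    = (\<Sum>I\<in>Pow S. (-1) ^ card I * Min (insert c (d ` I)))
      - (\<Sum>I\<in>Pow S. (-1) ^ card I * Min (insert (min c (d j)) (d ` I)))"
proof -
  have disj: "Pow S \<inter> insert j ` Pow S = {}" using assms(2) by auto
  have inj: "inj_on (insert j) (Pow S)" using assms(2) by (fastforce simp: inj_on_def)
  have fin: "finite (d ` I)" "finite I" "j \<notin> I" if "I \<in> Pow S" for I
    using that assms finite_subset by auto
  have "(\<Sum>I\<in>insert j ` Pow S. (-1) ^ card I * Min (insert c (d ` I)))
      = (\<Sum>I\<in>Pow S. - ((-1) ^ card I * Min (insert (min c (d j)) (d ` I))))"
    unfolding sum.reindex[OF inj] comp_def
  proof (rule sum.cong[OF refl])
    fix I assume I: "I \<in> Pow S"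
    have "Min (insert c (insert (d j) (d ` I))) = Min (insert (min c (d j)) (d ` I))"
      using fin(1)[OF I] by (cases "d ` I = {}") (simp_all add: min.assoc)
    then show "(-1) ^ card (insert j I) * Min (insert c (d ` insert j I))
        = - ((-1) ^ card I * Min (insert (min c (d j)) (d ` I)))"
      using fin(2,3)[OF I] by simp
  qed
  then show ?thesis
    unfolding Pow_insert using assms(1) disj by (subst sum.union_disjoint) (auto simp: sum_negf)
qed

text \<open>
  The alternating sum over a nonempty \<open>S\<close> equals the excess of \<open>c\<close> over the maximum of \<open>d\<close> if this is
  positive, and zero otherwise.  Monotonicity in \<open>c\<close> is the part of this that carries itself through
  the induction and yields nonnegativity at the next step.
\<close>

lemma mono_alternating_Min_sum:
  fixes d :: "'i \<Rightarrow> real"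
  assumes "finite S"
  shows "mono (\<lambda>c. \<Sum>I\<in>Pow S. (-1) ^ card I * Min (insert c (d ` I)))"
  using assms
proof (induction S rule: finite_induct)
  case empty
  then show ?case by (simp add: mono_def)
next
  case (insert j S)
  let ?\<Phi> = "\<lambda>c. \<Sum>I\<in>Pow S. (-1) ^ card I * Min (insert c (d ` I))"
  have "?\<Phi> c - ?\<Phi> (min c (d j)) \<le> ?\<Phi> c' - ?\<Phi> (min c' (d j))" if "c \<le> c'" for c c'
  proof -
    consider "c' \<le> d j" | "c \<le> d j" "d j \<le> c'" | "d j \<le> c" by linarith
    then show ?thesis
      using that monoD[OF insert.IH, of c c'] monoD[OF insert.IH, of "d j" c']
      by cases (simp_all add: min_absorb1 min_absorb2)
  qed
  then show ?case
    unfolding alternating_Min_sum_insert[OF insert.hyps] by (intro monoI)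
qed

lemma alternating_Min_sum_nonneg:
  fixes d :: "'i \<Rightarrow> real"
  assumes "finite S" "S \<noteq> {}"
  shows "0 \<le> (\<Sum>I\<in>Pow S. (-1) ^ card I * Min (insert c (d ` I)))"
proof -
  obtain j T where S: "S = insert j T" "j \<notin> T" using assms(2) by (meson ex_in_conv mk_disjoint_insert)
  then have T: "finite T" using assms(1) by simp
  show ?thesis
    unfolding S(1) alternating_Min_sum_insert[OF T S(2)]
    using monoD[OF mono_alternating_Min_sum[OF T], of "min c (d j)" c d] by simp
qed

lemma gamble_Min:
  assumes "finite I" "gamble f" "\<And>i. i \<in> I \<Longrightarrow> gamble (g i)"
  shows "gamble (\<lambda>x. Min (insert (f x) ((\<lambda>i. g i x) ` I)))"
  using assms
proof (induction I rule: finite_induct)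
  case (insert i I)
  then show ?case
    using gamble_min[of "\<lambda>x. Min (insert (f x) ((\<lambda>i. g i x) ` I))" "g i"]
    by (simp add: Min_insert_insert del: Min_insert)
qed simp

lemma filter_inf_Min:
  assumes F: "F \<noteq> bot" and "finite I" "gamble f" "\<And>i. i \<in> I \<Longrightarrow> gamble (g i)"
  shows "filter_inf F (\<lambda>x. Min (insert (f x) ((\<lambda>i. g i x) ` I)))
    = Min (insert (filter_inf F f) ((\<lambda>i. filter_inf F (g i)) ` I))"
  using assms(2-)
proof (induction I rule: finite_induct)
  case (insert i I)
  then show ?case
    using filter_inf_min[OF F gamble_Min[of I f g], of "g i"]
    by (simp add: Min_insert_insert del: Min_insert)
qed simp

section \<open>The quantile filters of a p-box\<close>

lemma not_le_imp_less:
  fixes x y :: "'a::bounded_total_preorder"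
  shows "\<not> x \<le> y \<Longrightarrow> y < x"
  using comparable less_le_not_le by blast

lemma option_comparable:
  fixes c d :: "'a::bounded_total_preorder option"
  shows "c \<le> d \<or> d \<le> c"
  using comparable by (cases c; cases d) auto

lemma option_not_less_imp_le:
  fixes c d :: "'a::bounded_total_preorder option"
  shows "\<not> c < d \<Longrightarrow> d \<le> c"
  using option_comparable less_le_not_le by blast

text \<open>
  The left end point \<open>None\<close> stands for a point strictly below the whole space, where every
  distribution function vanishes.  It is needed because the smallest element may carry positive
  probability, so that \<open>{bot<..x}\<close> does not replace the initial segment.
\<close>

definition interval :: "'a::bounded_total_preorder option \<Rightarrow> 'a \<Rightarrow> 'a set" where
  "interval c x = {z. c < Some z \<and> z \<le> x}"

definition cut_value :: "('a \<Rightarrow> real) \<Rightarrow> 'a option \<Rightarrow> real" where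
  "cut_value F c = (case c of None \<Rightarrow> 0 | Some y \<Rightarrow> F y)"

lemma cut_value_simps [simp]: "cut_value F None = 0" "cut_value F (Some y) = F y"
  by (simp_all add: cut_value_def)

lemma pboxD:
  assumes "pbox Fl Fu"
  shows "x \<le> y \<Longrightarrow> Fl x \<le> Fl y" "x \<le> y \<Longrightarrow> Fu x \<le> Fu y" "Fl x \<le> Fu x"
    "0 \<le> Fl x" "0 \<le> Fu x" "Fl x \<le> 1" "Fu x \<le> 1" "Fl top = 1"
  using assms unfolding pbox_def cdf_on_preorder_def by (auto simp: monotone_def image_subset_iff)

lemma cut_value_nonneg: "pbox Fl Fu \<Longrightarrow> 0 \<le> cut_value Fu c"
  by (cases c) (simp_all add: pboxD)

lemma cut_value_mono: "pbox Fl Fu \<Longrightarrow> c \<le> d \<Longrightarrow> cut_value Fu c \<le> cut_value Fu d"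
  by (cases c; cases d) (simp_all add: pboxD)

text \<open>
  From \<open>Fu y < Fl x \<le> Fu x\<close> and monotonicity, \<open>x\<close> cannot lie below \<open>y\<close>.  All nontriviality of
  the quantile filters rests on this.
\<close>

lemma right_end_in_interval:
  assumes "pbox Fl Fu" "cut_value Fu c < Fl x" shows "x \<in> interval c x"
proof (cases c)
  case (Some y)
  then have "Fu y < Fu x" using assms(2) pboxD(3)[OF assms(1), of x] by simp
  then have "\<not> x \<le> y" using pboxD(2)[OF assms(1)] by (meson not_le)
  then show ?thesis using Some by (simp add: interval_def not_le_imp_less)
qed (simp add: interval_def)

text \<open>
  The inequalities are strict on both sides.  For a given event this affects only a null set of
  levels, and it makes the levels compatible with an interval an open set, so that no question of
  measurability arises for the uncountable unions below.
\<close>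

definition quantile_filter ::
  "('a::bounded_total_preorder \<Rightarrow> real) \<Rightarrow> ('a \<Rightarrow> real) \<Rightarrow> real \<Rightarrow> 'a filter" where
  "quantile_filter Fl Fu u =
     (INF (c, x) \<in> {(c, x). cut_value Fu c < u \<and> u < Fl x}. principal (interval c x))"

lemma interval_Int:
  obtains c' x' where "c' \<in> {c, d}" "x' \<in> {x, y}" "interval c' x' \<subseteq> interval c x \<inter> interval d y"
proof -
  obtain c' where c': "c' \<in> {c, d}" "c \<le> c'" "d \<le> c'" using option_comparable[of c d] by blast
  obtain x' where x': "x' \<in> {x, y}" "x' \<le> x" "x' \<le> y" using comparable[of x y] by blast
  have "interval c' x' \<subseteq> interval c x \<inter> interval d y"
    unfolding interval_def using c'(2,3) x'(2,3) by (auto intro: le_less_trans order_trans)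
  then show ?thesis using that c'(1) x'(1) by blast
qed

lemma eventually_quantile_filter:
  assumes pbox: "pbox Fl Fu" and u: "0 < u" "u < 1"
  shows "eventually P (quantile_filter Fl Fu u)
    \<longleftrightarrow> (\<exists>c x. cut_value Fu c < u \<and> u < Fl x \<and> (\<forall>z\<in>interval c x. P z))"
proof -
  let ?B = "{(c, x). cut_value Fu c < u \<and> u < Fl x}"
  have "(None, top) \<in> ?B" using u pboxD(8)[OF pbox] by simp
  then have ne: "?B \<noteq> {}" by blast
  have dir: "\<exists>r\<in>?B. principal (case r of (c, x) \<Rightarrow> interval c x)
      \<le> inf (principal (case p of (c, x) \<Rightarrow> interval c x)) (principal (case q of (c, x) \<Rightarrow> interval c x))"
    if pq: "p \<in> ?B" "q \<in> ?B" for p q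
  proof -
    obtain c x d y where p: "p = (c, x)" and q: "q = (d, y)" by (cases p, cases q)
    obtain c' x' where r: "c' \<in> {c, d}" "x' \<in> {x, y}" "interval c' x' \<subseteq> interval c x \<inter> interval d y"
      by (rule interval_Int)
    then have "(c', x') \<in> ?B" using pq p q by auto
    then show ?thesis using r(3) p q by (intro bexI[of _ "(c', x')"]) auto
  qed
  have "quantile_filter Fl Fu u = (INF r\<in>?B. principal (case r of (c, x) \<Rightarrow> interval c x))"
    unfolding quantile_filter_def by (simp add: case_prod_unfold)
  then have "eventually P (quantile_filter Fl Fu u)
      \<longleftrightarrow> (\<exists>r\<in>?B. eventually P (principal (case r of (c, x) \<Rightarrow> interval c x)))"
    using eventually_INF_base[OF ne dir] by simp
  then show ?thesis by (auto simp: eventually_principal)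
qed

lemma quantile_filter_ne_bot:
  assumes pbox: "pbox Fl Fu" and u: "0 < u" "u < 1"
  shows "quantile_filter Fl Fu u \<noteq> bot"
proof
  assume "quantile_filter Fl Fu u = bot"
  then have "\<forall>\<^sub>F z in quantile_filter Fl Fu u. False" by simp
  then obtain c x where "cut_value Fu c < u" "u < Fl x" "interval c x = {}"
    unfolding eventually_quantile_filter[OF assms] by blast
  then show False using right_end_in_interval[OF pbox, of c x] by auto
qed

text \<open>
  The levels at which the quantile is certain to lie in \<open>A\<close>; see \<open>eventually_in_quantile_filter\<close>.
\<close>

definition quantile_levels ::
  "('a::bounded_total_preorder \<Rightarrow> real) \<Rightarrow> ('a \<Rightarrow> real) \<Rightarrow> 'a set \<Rightarrow> real set" where
  "quantile_levels Fl Fu A = (\<Union>(c, x)\<in>{(c, x). interval c x \<subseteq> A}. {cut_value Fu c<..<Fl x})"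

lemma mem_quantile_levels:
  "u \<in> quantile_levels Fl Fu A \<longleftrightarrow> (\<exists>c x. interval c x \<subseteq> A \<and> cut_value Fu c < u \<and> u < Fl x)"
  unfolding quantile_levels_def by auto

lemma open_quantile_levels: "open (quantile_levels Fl Fu A)"
  unfolding quantile_levels_def by (intro open_UN) auto

lemma quantile_levels_subset:
  assumes "pbox Fl Fu" shows "quantile_levels Fl Fu A \<subseteq> {0<..<1}"
proof
  fix u assume "u \<in> quantile_levels Fl Fu A"
  then obtain c x where "cut_value Fu c < u" "u < Fl x" unfolding mem_quantile_levels by blast
  then show "u \<in> {0<..<1}"
    using cut_value_nonneg[OF assms, of c] pboxD(6)[OF assms, of x] by simp
qed

lemma eventually_in_quantile_filter:
  assumes "pbox Fl Fu" "0 < u" "u < 1"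
  shows "(\<forall>\<^sub>F z in quantile_filter Fl Fu u. z \<in> A) \<longleftrightarrow> u \<in> quantile_levels Fl Fu A"
  unfolding eventually_quantile_filter[OF assms] mem_quantile_levels by blast

text \<open>
  An interval inside an initial segment has its right end point there, so its levels stay below
  \<open>Fl x\<close>.
\<close>

lemma quantile_levels_down:
  assumes "pbox Fl Fu" shows "quantile_levels Fl Fu {bot..x} = {0<..<Fl x}"
proof (intro set_eqI iffI)
  fix u assume "u \<in> quantile_levels Fl Fu {bot..x}"
  then obtain c x' where *: "interval c x' \<subseteq> {bot..x}" "cut_value Fu c < u" "u < Fl x'"
    unfolding mem_quantile_levels by blast
  then have "x' \<le> x" using right_end_in_interval[OF assms, of c x'] by auto
  then have "Fl x' \<le> Fl x" by (rule pboxD(1)[OF assms])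
  then show "u \<in> {0<..<Fl x}" using * cut_value_nonneg[OF assms, of c] by simp
next
  fix u assume u: "u \<in> {0<..<Fl x}"
  have "interval None x \<subseteq> {bot..x}" by (auto simp: interval_def bot_smallest)
  moreover have "cut_value Fu None < u" "u < Fl x" using u by simp_all
  ultimately show "u \<in> quantile_levels Fl Fu {bot..x}" unfolding mem_quantile_levels by blast
qed

text \<open>
  If an interval inside \<open>{y<..top}\<close> started strictly below \<open>y\<close>, it would contain \<open>y\<close>, since it
  contains its right end point, which is above \<open>y\<close>.
\<close>

lemma quantile_levels_up:
  assumes "pbox Fl Fu" shows "quantile_levels Fl Fu {y<..top} = {Fu y<..<1}"
proof (intro set_eqI iffI)
  fix u assume "u \<in> quantile_levels Fl Fu {y<..top}"
  then obtain c x where *: "interval c x \<subseteq> {y<..top}" "cut_value Fu c < u" "u < Fl x"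
    unfolding mem_quantile_levels by blast
  have "y < x" using right_end_in_interval[OF assms, of c x] * by auto
  have "\<not> c < Some y"
  proof
    assume "c < Some y"
    then have "y \<in> interval c x" using \<open>y < x\<close> by (simp add: interval_def less_imp_le)
    then show False using *(1) by auto
  qed
  then have "Fu y \<le> cut_value Fu c"
    using cut_value_mono[OF assms option_not_less_imp_le[of c "Some y"]] by simp
  then show "u \<in> {Fu y<..<1}" using * pboxD(6)[OF assms, of x] by simp
next
  fix u assume u: "u \<in> {Fu y<..<1}"
  have "interval (Some y) top \<subseteq> {y<..top}" by (auto simp: interval_def)
  moreover have "cut_value Fu (Some y) < u" "u < Fl top" using u pboxD(8)[OF assms] by simp_all
  ultimately show "u \<in> quantile_levels Fl Fu {y<..top}" unfolding mem_quantile_levels by blast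
qed

section \<open>Averaging over the quantile level\<close>

definition uniform01 :: "real measure" where
  "uniform01 = restrict_space lborel {0<..<1}"

lemma space_uniform01 [simp]: "space uniform01 = {0<..<1}"
  by (simp add: uniform01_def space_restrict_space)

lemma measure_uniform01: "U \<subseteq> {0<..<1} \<Longrightarrow> measure uniform01 U = measure lborel U"
  by (simp add: uniform01_def measure_restrict_space)

lemma open_in_sets_uniform01: "open U \<Longrightarrow> U \<subseteq> {0<..<1} \<Longrightarrow> U \<in> sets uniform01"
  by (simp add: uniform01_def sets_restrict_space_iff)

interpretation uniform01: finite_measure uniform01
  by (rule finite_measureI) (simp add: uniform01_def emeasure_restrict_space space_restrict_space)

lemma measure_uniform01_UNIV [simp]: "measure uniform01 {0<..<1} = 1"
  by (simp add: measure_uniform01)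

definition pbox_prevision ::
  "('a::bounded_total_preorder \<Rightarrow> real) \<Rightarrow> ('a \<Rightarrow> real) \<Rightarrow> ('a \<Rightarrow> real) \<Rightarrow> real" where
  "pbox_prevision Fl Fu f = (\<integral>u. filter_inf (quantile_filter Fl Fu u) f \<partial>uniform01)"

lemma integrable_quantile_inf:
  assumes pbox: "pbox Fl Fu" and f: "gamble f"
  shows "integrable uniform01 (\<lambda>u. filter_inf (quantile_filter Fl Fu u) f)"
proof -
  let ?V = "\<lambda>u. filter_inf (quantile_filter Fl Fu u) f"
  have "?V \<in> borel_measurable uniform01"
  proof (rule borel_measurableI_greater)
    fix t
    \<comment> \<open>The essential infimum is lower semicontinuous in the level: it exceeds \<open>t\<close> on an open set.\<close>
    let ?U = "\<Union>s\<in>{t<..}. quantile_levels Fl Fu {z. s \<le> f z}"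
    have "{u \<in> space uniform01. t < ?V u} = ?U"
    proof (intro set_eqI iffI)
      fix u assume "u \<in> {u \<in> space uniform01. t < ?V u}"
      then have u: "0 < u" "u < 1" and "t < ?V u" by auto
      then obtain s where "t < s" "\<forall>\<^sub>F z in quantile_filter Fl Fu u. z \<in> {z. s \<le> f z}"
        using less_filter_inf_iff[OF quantile_filter_ne_bot[OF pbox u] f, of t] by auto
      then show "u \<in> ?U" using eventually_in_quantile_filter[OF pbox u] by blast
    next
      fix u assume "u \<in> ?U"
      then obtain s where s: "t < s" "u \<in> quantile_levels Fl Fu {z. s \<le> f z}" by blast
      then have u: "0 < u" "u < 1" using subsetD[OF quantile_levels_subset[OF pbox] s(2)] by auto
      have "\<forall>\<^sub>F z in quantile_filter Fl Fu u. s \<le> f z"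
        using s(2) eventually_in_quantile_filter[OF pbox u, of "{z. s \<le> f z}"] by simp
      then have "t < ?V u"
        unfolding less_filter_inf_iff[OF quantile_filter_ne_bot[OF pbox u] f] using s(1) by blast
      then show "u \<in> {u \<in> space uniform01. t < ?V u}" using u by simp
    qed
    moreover have "?U \<in> sets uniform01"
      using quantile_levels_subset[OF pbox]
      by (intro open_in_sets_uniform01 open_UN ballI open_quantile_levels) blast
    ultimately show "{u \<in> space uniform01. t < ?V u} \<in> sets uniform01" by simp
  qed
  moreover obtain B where B: "\<forall>x. \<bar>f x\<bar> \<le> B"
    using f unfolding gamble_iff_bounds by blast
  have "\<bar>?V u\<bar> \<le> B" if "0 < u" "u < 1" for u
  proof -
    note ne = quantile_filter_ne_bot[OF pbox that]
    have bounds: "- B \<le> f x" "f x \<le> B" for x using spec[OF B, of x] by (simp_all add: abs_le_iff)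
    have "- B \<le> ?V u" by (rule coherent_ge_const[OF coherent_filter_inf[OF ne] f bounds(1)])
    moreover have "?V u \<le> B" by (rule filter_inf_le[OF ne f bounds(2)])
    ultimately show ?thesis by simp
  qed
  then have "AE u in uniform01. norm (?V u) \<le> B" by (intro AE_I2) simp
  ultimately show ?thesis by (rule uniform01.integrable_const_bound[rotated])
qed

lemma coherent_pbox_prevision:
  assumes pbox: "pbox Fl Fu" shows "coherent (pbox_prevision Fl Fu)"
proof -
  note coh = coherent_filter_inf[OF quantile_filter_ne_bot[OF pbox]]
  note int = integrable_quantile_inf[OF pbox]
  show ?thesis
    unfolding coherent_def
  proof (intro conjI allI impI)
    fix f :: "'a \<Rightarrow> real" assume f: "gamble f"
    have "(\<integral>u. (INF x. f x) \<partial>uniform01) \<le> pbox_prevision Fl Fu f"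
      unfolding pbox_prevision_def
      by (intro integral_mono int f coherent_ge_const[OF coh] gamble_Inf_le) auto
    then show "(INF x. f x) \<le> pbox_prevision Fl Fu f" by simp
  next
    fix f :: "'a \<Rightarrow> real" and c :: real assume f: "gamble f" and c: "0 \<le> c"
    have "pbox_prevision Fl Fu (\<lambda>x. c * f x)
        = (\<integral>u. c * filter_inf (quantile_filter Fl Fu u) f \<partial>uniform01)"
      unfolding pbox_prevision_def
      by (intro Bochner_Integration.integral_cong refl coherent_scale[OF coh f] c) auto
    then show "pbox_prevision Fl Fu (\<lambda>x. c * f x) = c * pbox_prevision Fl Fu f"
      by (simp add: pbox_prevision_def)
  next
    fix f g :: "'a \<Rightarrow> real" assume f: "gamble f" and g: "gamble g"
    have "pbox_prevision Fl Fu f + pbox_prevision Fl Fu g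
        = (\<integral>u. filter_inf (quantile_filter Fl Fu u) f + filter_inf (quantile_filter Fl Fu u) g \<partial>uniform01)"
      unfolding pbox_prevision_def by (simp add: int f g)
    also have "\<dots> \<le> pbox_prevision Fl Fu (\<lambda>x. f x + g x)"
      unfolding pbox_prevision_def
      by (intro integral_mono int gamble_add f g coherent_superadditive[OF coh]
          Bochner_Integration.integrable_add) auto
    finally show "pbox_prevision Fl Fu f + pbox_prevision Fl Fu g
        \<le> pbox_prevision Fl Fu (\<lambda>x. f x + g x)" .
  qed
qed

lemma pbox_prevision_indicator:
  assumes pbox: "pbox Fl Fu"
  shows "pbox_prevision Fl Fu (indicator A) = measure lborel (quantile_levels Fl Fu A)"
proof -
  let ?U = "quantile_levels Fl Fu A"
  have "pbox_prevision Fl Fu (indicator A) = (\<integral>u. indicator ?U u \<partial>uniform01)"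
    unfolding pbox_prevision_def
  proof (rule Bochner_Integration.integral_cong[OF refl])
    fix u assume "u \<in> space uniform01"
    then have u: "0 < u" "u < 1" by auto
    show "filter_inf (quantile_filter Fl Fu u) (indicator A) = indicator ?U u"
      by (simp add: filter_inf_indicator[OF quantile_filter_ne_bot[OF pbox u]]
          eventually_in_quantile_filter[OF pbox u] indicator_def)
  qed
  also have "\<dots> = measure lborel ?U"
    using quantile_levels_subset[OF pbox, of A]
    by (simp add: measure_uniform01 Int_absorb2)
  finally show ?thesis .
qed

lemma pbox_prevision_extension:
  assumes pbox: "pbox Fl Fu" shows "coherent_extension Fl Fu (pbox_prevision Fl Fu)"
  unfolding coherent_extension_def
  by (simp add: coherent_pbox_prevision[OF pbox] pbox_prevision_indicator[OF pbox]
      quantile_levels_down[OF pbox] quantile_levels_up[OF pbox] pboxD[OF pbox])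

text \<open>
  The upper sum inequality fails for general coherent previsions; here it holds because it holds at
  each level.
\<close>

lemma pbox_prevision_layer_sum:
  assumes pbox: "pbox Fl Fu" and f: "gamble f" and n: "0 < n"
  shows "pbox_prevision Fl Fu f
    \<le> (INF x. f x) + (\<Sum>k<n. layer_step f n * pbox_prevision Fl Fu (indicator (layer f n k)))"
proof -
  let ?V = "\<lambda>u. filter_inf (quantile_filter Fl Fu u)"
  note int = integrable_quantile_inf[OF pbox]
  have "pbox_prevision Fl Fu f
      \<le> (\<integral>u. (INF x. f x) + (\<Sum>k<n. layer_step f n * ?V u (indicator (layer f n k))) \<partial>uniform01)"
    unfolding pbox_prevision_def
  proof (rule integral_mono)
    fix u assume "u \<in> space uniform01"
    then show "?V u f \<le> (INF x. f x) + (\<Sum>k<n. layer_step f n * ?V u (indicator (layer f n k)))"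
      by (intro filter_inf_layer_sums quantile_filter_ne_bot[OF pbox] f n) auto
  qed (intro Bochner_Integration.integrable_add uniform01.integrable_const
      Bochner_Integration.integrable_sum integrable_mult_right int f gamble_indicator)+
  also have "\<dots> = (INF x. f x) + (\<Sum>k<n. layer_step f n * pbox_prevision Fl Fu (indicator (layer f n k)))"
    by (simp add: pbox_prevision_def int)
  finally show ?thesis .
qed

lemma conjugate_pbox_prevision:
  "conjugate (pbox_prevision Fl Fu) f = (\<integral>u. conjugate (filter_inf (quantile_filter Fl Fu u)) f \<partial>uniform01)"
  by (simp add: conjugate_def pbox_prevision_def)

lemma conjugate_pbox_prevision_layer_sums:
  fixes Fl Fu :: "'a::bounded_total_preorder \<Rightarrow> real"
  assumes pbox: "pbox Fl Fu" and f: "gamble f" and n: "0 < n"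
  defines "E \<equiv> conjugate (pbox_prevision Fl Fu)"
  shows "(INF x. f x) + (\<Sum>k<n. layer_step f n * E (indicator (layer f n (Suc k)))) \<le> E f"
    and "E f \<le> (INF x. f x) + (\<Sum>k<n. layer_step f n * E (indicator (layer f n k)))"
proof -
  let ?V = "\<lambda>u. conjugate (filter_inf (quantile_filter Fl Fu u))"
  have int: "integrable uniform01 (\<lambda>u. ?V u g)" if "gamble g" for g
    unfolding conjugate_def using integrable_quantile_inf[OF pbox gamble_uminus[OF that]] by simp
  have E: "E g = (\<integral>u. ?V u g \<partial>uniform01)" for g
    unfolding E_def by (rule conjugate_pbox_prevision)
  have sum: "(INF x. f x) + (\<Sum>k<n. layer_step f n * E (indicator (layer f n (j k))))
      = (\<integral>u. (INF x. f x) + (\<Sum>k<n. layer_step f n * ?V u (indicator (layer f n (j k)))) \<partial>uniform01)"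
    for j by (simp add: E int)
  have intsum: "integrable uniform01
      (\<lambda>u. (INF x. f x) + (\<Sum>k<n. layer_step f n * ?V u (indicator (layer f n (j k)))))" for j
    by (intro Bochner_Integration.integrable_add uniform01.integrable_const
      Bochner_Integration.integrable_sum integrable_mult_right int gamble_indicator)
  note pointwise = conjugate_filter_inf_layer_sums[OF quantile_filter_ne_bot[OF pbox] f n]
  show "(INF x. f x) + (\<Sum>k<n. layer_step f n * E (indicator (layer f n (Suc k)))) \<le> E f"
    unfolding sum[of Suc] E[of f] by (rule integral_mono[OF intsum int[OF f] pointwise(1)]) auto
  show "E f \<le> (INF x. f x) + (\<Sum>k<n. layer_step f n * E (indicator (layer f n k)))"
    unfolding sum[of "\<lambda>k. k"] E[of f] by (rule integral_mono[OF int[OF f] intsum pointwise(2)]) auto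
qed

lemma completely_monotone_pbox_prevision:
  assumes pbox: "pbox Fl Fu" shows "completely_monotone (pbox_prevision Fl Fu)"
  unfolding completely_monotone_def
proof (intro allI impI)
  fix p :: nat and f :: "'a \<Rightarrow> real" and g :: "nat \<Rightarrow> 'a \<Rightarrow> real"
  assume p: "1 \<le> p" and f: "gamble f" and g: "\<forall>i\<in>{1..p}. gamble (g i)"
  let ?S = "{1..p}"
  let ?m = "\<lambda>I x. Min (insert (f x) ((\<lambda>i. g i x) ` I))"
  let ?V = "\<lambda>u. filter_inf (quantile_filter Fl Fu u)"
  have m: "gamble (?m I)" if "I \<in> Pow ?S" for I
    using that g by (intro gamble_Min f) (auto intro: finite_subset)
  have "(\<Sum>I\<in>Pow ?S. (-1) ^ card I * pbox_prevision Fl Fu (?m I))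
      = (\<integral>u. (\<Sum>I\<in>Pow ?S. (-1) ^ card I * ?V u (?m I)) \<partial>uniform01)"
    unfolding pbox_prevision_def
    using integrable_quantile_inf[OF pbox m] by (subst Bochner_Integration.integral_sum) auto
  also have "0 \<le> \<dots>"
  proof (rule Bochner_Integration.integral_nonneg)
    fix u assume "u \<in> space uniform01"
    then have ne: "quantile_filter Fl Fu u \<noteq> bot" by (intro quantile_filter_ne_bot[OF pbox]) auto
    have "(\<Sum>I\<in>Pow ?S. (-1) ^ card I * ?V u (?m I))
        = (\<Sum>I\<in>Pow ?S. (-1) ^ card I * Min (insert (?V u f) ((\<lambda>i. ?V u (g i)) ` I)))"
    proof (rule sum.cong[OF refl])
      fix I assume I: "I \<in> Pow ?S"
      have "?V u (?m I) = Min (insert (?V u f) ((\<lambda>i. ?V u (g i)) ` I))"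
        using I g by (intro filter_inf_Min[OF ne _ f]) (auto intro: finite_subset)
      then show "(-1) ^ card I * ?V u (?m I)
          = (-1) ^ card I * Min (insert (?V u f) ((\<lambda>i. ?V u (g i)) ` I))" by simp
    qed
    also have "0 \<le> \<dots>" using p by (intro alternating_Min_sum_nonneg) auto
    finally show "0 \<le> (\<Sum>I\<in>Pow ?S. (-1) ^ card I * ?V u (?m I))" .
  qed
  finally show "0 \<le> (\<Sum>I\<in>Pow ?S. (-1) ^ card I * pbox_prevision Fl Fu (?m I))" .
qed

section \<open>Minimality among the coherent extensions\<close>

text \<open>
  In a total preorder, two intervals with a common point \<open>w\<close> have an interval as their union:
  points up to \<open>w\<close> lie in the interval that starts first, points above \<open>w\<close> in the one that ends last.
\<close>

lemma interval_Un:
  assumes "interval c x \<inter> interval d y \<noteq> {}"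
  obtains c' x' where "c' \<in> {c, d}" "c' \<le> c" "c' \<le> d" "x' \<in> {x, y}" "x \<le> x'" "y \<le> x'"
    "interval c' x' \<subseteq> interval c x \<union> interval d y"
proof -
  obtain w where w: "c < Some w" "d < Some w" "w \<le> x" "w \<le> y"
    using assms by (auto simp: interval_def)
  obtain c' where c': "c' \<in> {c, d}" "c' \<le> c" "c' \<le> d" using option_comparable[of c d] by blast
  obtain x' where x': "x' \<in> {x, y}" "x \<le> x'" "y \<le> x'" using comparable[of x y] by blast
  have "z \<in> interval c x \<union> interval d y" if z: "z \<in> interval c' x'" for z
  proof (cases "z \<le> w")
    case True
    then have "z \<le> x" "z \<le> y" using w(3,4) order_trans by blast+
    then show ?thesis using z c'(1) by (auto simp: interval_def)
  next
    case False
    then have "Some w \<le> Some z" using comparable[of z w] by simp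
    then have "c < Some z" "d < Some z" using w(1,2) less_le_trans by blast+
    then show ?thesis using z x'(1) by (auto simp: interval_def)
  qed
  then have "interval c' x' \<subseteq> interval c x \<union> interval d y" by (rule subsetI)
  then show ?thesis by (rule that[OF c' x'])
qed

text \<open>
  Merging two intervals that meet widens the range of levels and stays inside \<open>A\<close>, while the
  number of intervals drops.  A family of least cardinality that still covers the levels of \<open>S\<close> is
  therefore disjoint.
\<close>

lemma disjoint_interval_refinement:
  assumes pbox: "pbox Fl Fu" and fin: "finite S"
    and S: "\<forall>(c, x)\<in>S. cut_value Fu c < Fl x \<and> interval c x \<subseteq> A"
  shows "\<exists>T. finite T \<and> (\<forall>(c, x)\<in>T. cut_value Fu c < Fl x \<and> interval c x \<subseteq> A)
    \<and> (\<Union>(c, x)\<in>S. {cut_value Fu c<..<Fl x}) \<subseteq> (\<Union>(c, x)\<in>T. {cut_value Fu c<..<Fl x})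
    \<and> disjoint_family_on (\<lambda>(c, x). interval c x) T"
proof -
  let ?J = "\<lambda>T. \<Union>(c, x)\<in>T. {cut_value Fu c<..<Fl x}"
  define good where "good T \<longleftrightarrow> finite T
    \<and> (\<forall>(c, x)\<in>T. cut_value Fu c < Fl x \<and> interval c x \<subseteq> A) \<and> ?J S \<subseteq> ?J T" for T
  have "good S" using fin S by (simp add: good_def)
  then obtain T where T: "good T" and min: "\<forall>T'. good T' \<longrightarrow> card T \<le> card T'"
    using ex_has_least_nat[of good S card] by blast
  have fT: "finite T" and goodT: "\<forall>(c, x)\<in>T. cut_value Fu c < Fl x \<and> interval c x \<subseteq> A"
    and ST: "?J S \<subseteq> ?J T" using T by (simp_all add: good_def)
  have "(\<lambda>(c, x). interval c x) p \<inter> (\<lambda>(c, x). interval c x) q = {}"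
    if pq: "p \<in> T" "q \<in> T" "p \<noteq> q" for p q
  proof (rule ccontr)
    assume meet: "(\<lambda>(c, x). interval c x) p \<inter> (\<lambda>(c, x). interval c x) q \<noteq> {}"
    obtain c x d y where p: "p = (c, x)" and q: "q = (d, y)" by (cases p, cases q)
    obtain c' x' where r: "c' \<in> {c, d}" "c' \<le> c" "c' \<le> d" "x' \<in> {x, y}" "x \<le> x'" "y \<le> x'"
      "interval c' x' \<subseteq> interval c x \<union> interval d y"
      by (rule interval_Un[OF meet[unfolded p q prod.case]])
    have val: "cut_value Fu c' \<le> cut_value Fu c" "cut_value Fu c' \<le> cut_value Fu d"
      "Fl x \<le> Fl x'" "Fl y \<le> Fl x'"
      using cut_value_mono[OF pbox r(2)] cut_value_mono[OF pbox r(3)]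
        pboxD(1)[OF pbox r(5)] pboxD(1)[OF pbox r(6)] by auto
    have cxdy: "cut_value Fu c < Fl x" "interval c x \<subseteq> A" "interval d y \<subseteq> A"
      using bspec[OF goodT pq(1)] bspec[OF goodT pq(2)] by (simp_all add: p q)
    let ?T' = "insert (c', x') (T - {p, q})"
    have "good ?T'"
      unfolding good_def
    proof (intro conjI)
      have "cut_value Fu c' < Fl x'" "interval c' x' \<subseteq> A"
        using val(1,3) cxdy r(7) by (linarith, blast)
      then show "\<forall>(c, x)\<in>?T'. cut_value Fu c < Fl x \<and> interval c x \<subseteq> A"
        using goodT by simp
      have "?J T \<subseteq> ?J ?T'"
      proof
        fix u assume "u \<in> ?J T"
        then obtain b z where b: "(b, z) \<in> T" "cut_value Fu b < u" "u < Fl z" by auto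
        show "u \<in> ?J ?T'"
        proof (cases "(b, z) \<in> {p, q}")
          case True
          then have "cut_value Fu b \<ge> cut_value Fu c'" "Fl z \<le> Fl x'" using val by (auto simp: p q)
          then show ?thesis using b(2,3) by (intro UN_I[of "(c', x')"]) simp_all
        next
          case False
          then show ?thesis using b by (intro UN_I[of "(b, z)"]) simp_all
        qed
      qed
      with ST show "?J S \<subseteq> ?J ?T'" by (rule order_trans)
    qed (use fT in simp)
    then have "card T \<le> card ?T'" using min by blast
    also have "\<dots> \<le> Suc (card (T - {p, q}))" by (rule card_insert_le_m1) simp_all
    also have "\<dots> < card T"
    proof -
      have "card (T - {p, q}) = card T - 2" using fT pq by (simp add: card_Diff_subset)
      moreover have "2 \<le> card T" using card_mono[OF fT, of "{p, q}"] pq by simp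
      ultimately show ?thesis by simp
    qed
    finally show False by simp
  qed
  then have "disjoint_family_on (\<lambda>(c, x). interval c x) T" by (simp add: disjoint_family_on_def)
  then show ?thesis using fT goodT ST by blast
qed

text \<open>
  The indicator of \<open>(y, x]\<close> dominates the sum of the indicators of \<open>{bot..x}\<close> and \<open>{y<..top}\<close>
  minus one, in which both prescribed indicators occur with a positive coefficient, so that
  superadditivity applies.
\<close>

lemma coherent_extension_interval:
  assumes pbox: "pbox Fl Fu" and P: "coherent_extension Fl Fu P"
  shows "Fl x - cut_value Fu c \<le> P (indicator (interval c x))"
proof -
  have coh: "coherent P" and down: "P (indicator {bot..x}) = Fl x"
    and up: "P (indicator {y<..top}) = 1 - Fu y" for y
    using P by (auto simp: coherent_extension_def)
  show ?thesis
  proof (cases c)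
    case None
    have "interval None x = {bot..x}" by (auto simp: interval_def bot_smallest)
    then show ?thesis using None down by simp
  next
    case (Some y)
    let ?g = "\<lambda>z. indicator {bot..x} z + indicator {y<..top} z :: real"
    have g: "gamble ?g" by (rule gamble_add) simp_all
    have "Fl x - Fu y \<le> P ?g + (-1)"
      using coherent_superadditive[OF coh gamble_indicator[of "{bot..x}"] gamble_indicator[of "{y<..top}"]]
        down up[of y] by linarith
    also have "\<dots> \<le> P (\<lambda>z. ?g z + (-1))" by (rule coherent_add_const[OF coh g])
    also have "\<dots> \<le> P (indicator (interval c x))"
      by (rule coherent_mono[OF coh gamble_add[OF g gamble_const] gamble_indicator])
        (auto simp: indicator_def interval_def Some bot_smallest top_largest)
    finally show ?thesis using Some by simp
  qed
qed

text \<open>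
  The refinement makes the sum of the indicators of the intervals at most the indicator of \<open>A\<close>;
  superadditivity of \<open>P\<close> then meets subadditivity of the measure.
\<close>

lemma coherent_extension_finite_union:
  assumes pbox: "pbox Fl Fu" and P: "coherent_extension Fl Fu P" and fin: "finite S"
    and S: "\<forall>(c, x)\<in>S. cut_value Fu c < Fl x \<and> interval c x \<subseteq> A"
  shows "measure lborel (\<Union>(c, x)\<in>S. {cut_value Fu c<..<Fl x}) \<le> P (indicator A)"
proof -
  have coh: "coherent P" using P by (simp add: coherent_extension_def)
  let ?I = "\<lambda>(c, x). interval c x"
  obtain T where fT: "finite T" and T: "\<forall>(c, x)\<in>T. cut_value Fu c < Fl x \<and> interval c x \<subseteq> A"
    and cover: "(\<Union>(c, x)\<in>S. {cut_value Fu c<..<Fl x}) \<subseteq> (\<Union>(c, x)\<in>T. {cut_value Fu c<..<Fl x})"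
    and disj: "disjoint_family_on ?I T"
    using disjoint_interval_refinement[OF pbox fin S] by (elim exE conjE)
  have Tp: "cut_value Fu (fst p) < Fl (snd p)" "?I p \<subseteq> A" if "p \<in> T" for p
    using bspec[OF T that] by (simp_all add: case_prod_unfold)
  let ?J = "\<lambda>p. {cut_value Fu (fst p)<..<Fl (snd p)}"
  have fm: "\<Union>(?J ` T) \<in> fmeasurable lborel"
  proof (intro fmeasurable.finite_UN fT)
    fix p assume "p \<in> T"
    then have "cut_value Fu (fst p) \<le> Fl (snd p)" using Tp(1) less_imp_le by blast
    then show "?J p \<in> fmeasurable lborel" by (simp add: fmeasurable_def)
  qed
  have "measure lborel (\<Union>(c, x)\<in>S. {cut_value Fu c<..<Fl x}) \<le> measure lborel (\<Union>(?J ` T))"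
    using cover fin by (intro measure_mono_fmeasurable fm) (auto simp: case_prod_unfold)
  also have "\<dots> \<le> (\<Sum>p\<in>T. measure lborel (?J p))"
    using fT by (intro measure_UNION_le) auto
  also have "\<dots> \<le> (\<Sum>p\<in>T. P (indicator (?I p)))"
  proof (rule sum_mono)
    fix p assume "p \<in> T"
    then show "measure lborel (?J p) \<le> P (indicator (?I p))"
      using Tp(1)[of p] coherent_extension_interval[OF pbox P, of "snd p" "fst p"]
      by (simp add: case_prod_unfold)
  qed
  also have "\<dots> \<le> P (\<lambda>z. \<Sum>p\<in>T. indicator (?I p) z)"
    by (rule coherent_sum[OF coh gamble_indicator])
  also have "\<dots> \<le> P (indicator A)"
  proof (rule coherent_mono[OF coh gamble_sum gamble_indicator])
    fix z
    have "(\<Sum>p\<in>T. indicator (?I p) z :: real) = indicator (\<Union>p\<in>T. ?I p) z"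
      by (rule indicator_UN_disjoint[OF fT disj, symmetric])
    also have "\<dots> \<le> indicator A z"
      using Tp(2) by (auto simp: indicator_def of_bool_def)
    finally show "(\<Sum>p\<in>T. indicator (?I p) z :: real) \<le> indicator A z" .
  qed simp
  finally show ?thesis .
qed

text \<open>
  A compact subset of the open set of levels has nearly full measure and is covered by
  finitely many of the level intervals, which brings the previous bound into play.
\<close>

lemma pbox_prevision_indicator_le:
  assumes pbox: "pbox Fl Fu" and P: "coherent_extension Fl Fu P"
  shows "pbox_prevision Fl Fu (indicator A) \<le> P (indicator A)"
proof -
  let ?U = "quantile_levels Fl Fu A"
  have "measure lborel ?U \<le> P (indicator A) + e" if e: "0 < e" for e
  proof -
    have "?U \<in> sets lebesgue" by (intro sets_completionI_sets) (simp add: open_quantile_levels)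
    then obtain K where K: "closed K" "K \<subseteq> ?U" "?U - K \<in> lmeasurable" "emeasure lebesgue (?U - K) < ennreal e"
      using sets_lebesgue_inner_closed e by blast
    have "bounded K"
      using bounded_subset[OF _ order_trans[OF K(2) quantile_levels_subset[OF pbox]]]
        bounded_box[of "0::real" 1] by simp
    then have "compact K" using K(1) compact_eq_bounded_closed by blast
    \<comment> \<open>Pairs with \<open>Fl x \<le> cut_value Fu c\<close> contribute no levels, so they can be left out.\<close>
    let ?B = "{(c, x). cut_value Fu c < Fl x \<and> interval c x \<subseteq> A}"
    let ?j = "\<lambda>p. {cut_value Fu (fst p)<..<Fl (snd p)}"
    have "K \<subseteq> (\<Union>p\<in>?B. ?j p)"
    proof
      fix u assume "u \<in> K"
      then obtain c x where "interval c x \<subseteq> A" "cut_value Fu c < u" "u < Fl x"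
        using K(2) mem_quantile_levels by blast
      then show "u \<in> (\<Union>p\<in>?B. ?j p)" by (intro UN_I[of "(c, x)"]) simp_all
    qed
    then obtain S where S: "S \<subseteq> ?B" "finite S" "K \<subseteq> (\<Union>p\<in>S. ?j p)"
      by (rule compactE_image[OF \<open>compact K\<close> open_greaterThanLessThan])
    let ?J = "\<Union>(c, x)\<in>S. {cut_value Fu c<..<Fl x}"
    have J: "?J \<in> lmeasurable"
      using S(2) by (intro fmeasurable.finite_UN) (auto simp: case_prod_unfold)
    have "measure lebesgue ?U \<le> measure lebesgue (?J \<union> (?U - K))"
      using S(3) K(3) J \<open>?U \<in> sets lebesgue\<close>
      by (intro measure_mono_fmeasurable fmeasurable.Un) (auto simp: case_prod_unfold)
    also have "\<dots> \<le> measure lebesgue ?J + measure lebesgue (?U - K)"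
      using J K(3) by (intro measure_Un_le) auto
    also have "measure lebesgue ?J = measure lborel ?J"
      by (rule measure_completion) (use S(2) in \<open>auto simp: case_prod_unfold\<close>)
    also have "\<dots> \<le> P (indicator A)"
      by (rule coherent_extension_finite_union[OF pbox P S(2)]) (use S(1) in auto)
    also have "measure lebesgue (?U - K) \<le> e"
      using K(3,4) e by (simp add: emeasure_eq_measure2 ennreal_less_iff)
    also have "measure lebesgue ?U = measure lborel ?U"
      by (rule measure_completion) (simp add: open_quantile_levels)
    finally show ?thesis by simp
  qed
  then show ?thesis unfolding pbox_prevision_indicator[OF pbox] by (rule field_le_epsilon)
qed

lemma layer_sums_difference:
  assumes h: "\<And>k. 0 \<le> h k" "\<And>k. h k \<le> 1" and f: "gamble f" and n: "0 < n"
  shows "(\<Sum>k<n. layer_step f n * h k)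
    \<le> (\<Sum>k<n. layer_step f n * h (Suc k)) + ((SUP x. f x) - (INF x. f x)) / real n"
proof -
  have "(\<Sum>k<n. layer_step f n * h k) - (\<Sum>k<n. layer_step f n * h (Suc k))
      = layer_step f n * (\<Sum>k<n. h k - h (Suc k))"
    by (simp add: sum_distrib_left right_diff_distrib sum_subtractf)
  also have "\<dots> = layer_step f n * (h 0 - h n)" by (simp add: sum_lessThan_telescope')
  also have "\<dots> \<le> layer_step f n * 1"
    using h(1)[of n] h(2)[of 0] by (intro mult_left_mono layer_step_nonneg[OF f]) linarith
  finally show ?thesis by (simp add: layer_step_def)
qed

text \<open>
  On a gamble, \<open>P\<close> dominates its lower layer sum, which dominates that of \<open>pbox_prevision Fl Fu\<close> by
  the bound on events; the latter misses the upper layer sum, and hence \<open>pbox_prevision Fl Fu f\<close>, by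
  at most one step of the grid.
\<close>

lemma pbox_prevision_is_natural_extension:
  fixes Fl Fu :: "'a::bounded_total_preorder \<Rightarrow> real"
  assumes pbox: "pbox Fl Fu"
  shows "is_natural_extension Fl Fu (pbox_prevision Fl Fu)"
  unfolding is_natural_extension_def
proof (intro conjI allI impI pbox_prevision_extension[OF pbox])
  fix P and f :: "'a \<Rightarrow> real" assume P: "coherent_extension Fl Fu P" and f: "gamble f"
  let ?E = "pbox_prevision Fl Fu" and ?r = "(SUP x. f x) - (INF x. f x)"
  have coh: "coherent P" using P by (simp add: coherent_extension_def)
  have bound: "?E f \<le> P f + ?r / real n" if n: "0 < n" for n
  proof -
    have 0: "0 \<le> ?E (indicator A)" "?E (indicator A) \<le> 1" for A
      using coherent_ge_const[OF coherent_pbox_prevision[OF pbox] gamble_indicator, of 0 A]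
        coherent_mono[OF coherent_pbox_prevision[OF pbox] gamble_indicator gamble_const, of A 1]
        coherent_const[OF coherent_pbox_prevision[OF pbox], of 1]
      by (simp_all add: indicator_def)
    have "?E f \<le> (INF x. f x) + (\<Sum>k<n. layer_step f n * ?E (indicator (layer f n k)))"
      by (rule pbox_prevision_layer_sum[OF pbox f n])
    also have "(\<Sum>k<n. layer_step f n * ?E (indicator (layer f n k)))
        \<le> (\<Sum>k<n. layer_step f n * ?E (indicator (layer f n (Suc k)))) + ?r / real n"
      by (rule layer_sums_difference[OF 0 f n])
    also have "(\<Sum>k<n. layer_step f n * ?E (indicator (layer f n (Suc k))))
        \<le> (\<Sum>k<n. layer_step f n * P (indicator (layer f n (Suc k))))"
      by (intro sum_mono mult_left_mono pbox_prevision_indicator_le[OF pbox P] layer_step_nonneg[OF f])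
    finally show ?thesis using coherent_layer_sum[OF coh f n] by linarith
  qed
  have "?E f \<le> P f + ?r * (1 / real (Suc n))" for n using bound[of "Suc n"] by simp
  moreover have "(\<lambda>n. P f + ?r * (1 / real (Suc n))) \<longlonglongrightarrow> P f + ?r * 0"
    by (intro tendsto_intros LIMSEQ_Suc[OF lim_1_over_n])
  ultimately have "?E f \<le> P f + ?r * 0" by (intro LIMSEQ_le_const) auto
  then show "?E f \<le> P f" by simp
qed

lemma natural_extension_eq:
  assumes pbox: "pbox Fl Fu" and f: "gamble f"
  shows "natural_extension Fl Fu f = pbox_prevision Fl Fu f"
proof -
  note E = pbox_prevision_is_natural_extension[OF pbox]
  show ?thesis
    unfolding natural_extension_def
    by (rule natural_extension_unique[OF someI[of "is_natural_extension Fl Fu", OF E] E f])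
qed

lemma choquet_integral_cong:
  assumes "\<And>A. P (indicator A) = Q (indicator A)"
  shows "choquet_integral P f = choquet_integral Q f"
  using assms by (simp add: choquet_integral_def)

theorem theorem18:
  fixes Fl Fu :: "'a::bounded_total_preorder \<Rightarrow> real"
  assumes "pbox Fl Fu"
  shows "(\<forall>f. gamble f \<longrightarrow>
            natural_extension Fl Fu f = choquet_integral (natural_extension Fl Fu) f)
       \<and> completely_monotone (natural_extension Fl Fu)
       \<and> (\<forall>f. gamble f \<longrightarrow>
            conjugate (natural_extension Fl Fu) f
              = choquet_integral (conjugate (natural_extension Fl Fu)) f)"
proof (intro conjI allI impI)
  let ?N = "natural_extension Fl Fu" and ?E = "pbox_prevision Fl Fu"
  note eq = natural_extension_eq[OF assms] and coh = coherent_pbox_prevision[OF assms]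
  have conj_eq: "conjugate ?N f = conjugate ?E f" if "gamble f" for f
    by (simp add: conjugate_def eq[OF gamble_uminus[OF that]])
  have mono: "?E f \<le> ?E g" if "gamble f" "gamble g" "\<And>x. f x \<le> g x" for f g
    using that by (rule coherent_mono[OF coh])
  {
    fix f :: "'a \<Rightarrow> real" assume f: "gamble f"
    have "choquet_integral ?E f = ?E f"
    proof (rule choquet_integral_eqI[OF f])
      show "?E (indicator A) \<le> ?E (indicator B)" if "A \<subseteq> B" for A B
        using that by (intro mono) (auto simp: indicator_def)
    qed (rule coherent_layer_sum[OF coh f] pbox_prevision_layer_sum[OF assms f], assumption)+
    moreover have "choquet_integral ?N f = choquet_integral ?E f"
      by (rule choquet_integral_cong) (simp add: eq)
    ultimately show "?N f = choquet_integral ?N f" by (simp add: eq[OF f])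
  next
    fix f :: "'a \<Rightarrow> real" assume f: "gamble f"
    have "choquet_integral (conjugate ?E) f = conjugate ?E f"
    proof (rule choquet_integral_eqI[OF f])
      show "conjugate ?E (indicator A) \<le> conjugate ?E (indicator B)" if "A \<subseteq> B" for A B
        using mono[OF gamble_uminus gamble_uminus, OF gamble_indicator gamble_indicator, of B A] that
        by (auto simp: conjugate_def indicator_def)
    qed (rule conjugate_pbox_prevision_layer_sums[OF assms f], assumption)+
    moreover have "choquet_integral (conjugate ?N) f = choquet_integral (conjugate ?E) f"
      by (rule choquet_integral_cong) (simp add: conj_eq)
    ultimately show "conjugate ?N f = choquet_integral (conjugate ?N) f" by (simp add: conj_eq[OF f])
  }
  have "(\<Sum>I\<in>Pow {1..p}. (-1) ^ card I * ?N (\<lambda>x. Min (insert (f x) ((\<lambda>i. g i x) ` I))))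
      = (\<Sum>I\<in>Pow {1..p}. (-1) ^ card I * ?E (\<lambda>x. Min (insert (f x) ((\<lambda>i. g i x) ` I))))"
    if "gamble f" "\<forall>i\<in>{1..p}. gamble (g i)" for p f and g :: "nat \<Rightarrow> 'a \<Rightarrow> real"
  proof (rule sum.cong[OF refl])
    fix I assume "I \<in> Pow {1..p}"
    then have "gamble (\<lambda>x. Min (insert (f x) ((\<lambda>i. g i x) ` I)))"
      using that by (intro gamble_Min) (auto intro: finite_subset)
    then show "(-1) ^ card I * ?N (\<lambda>x. Min (insert (f x) ((\<lambda>i. g i x) ` I)))
        = (-1) ^ card I * ?E (\<lambda>x. Min (insert (f x) ((\<lambda>i. g i x) ` I)))" by (simp add: eq)
  qed
  then show "completely_monotone ?N"
    using completely_monotone_pbox_prevision[OF assms] unfolding completely_monotone_def by simp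
qed

end
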